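(* Let $\mathcal{C}$ be a target–context category with intrinsic behaviors in which $\mathrm{eval}\colon T\otimes C\to B$ is an $A$-complete parametrization of maps $C\to B$ (for some object $A$). If there exists a universal simulator $s\colon C\otimes C\to T\otimes C$ (i.e. with object of programs $C$), then every morphism $g\colon B\to B$ has a quasi-fixed point, i.e. a morphism $b$ with codomain $B$ such that $\overline b\succeq^{\rm im}\overline g\circ\overline b$.
   Context: $\mathcal{C}$ is a gs-monoidal category (symmetric monoidal with tensor $\otimes$, unit $I$, commutative comonoids $\mathrm{copy}_A\colon A\to A\otimes A$, $\mathrm{del}_A\colon A\to I$ compatible with $\otimes$, $\mathrm{del}_I=\mathrm{id}_I$), all of whose morphisms are normalized ($f\circ\mathrm{dom}(f)=f$, $\mathrm{dom}(f)=(\mathrm{id}_A\otimes(\mathrm{del}_X\circ f))\circ\mathrm{copy}_A$). $f$ is functional if $\mathrm{copy}_X\circ f=(f\otimes f)\circ\mathrm{copy}_A$. A lax gs-monoidal functor $\Phi\colon\mathcal{C}\to\mathbf{Rel}$ (sets and relations with cartesian product) is a lax symmetric monoidal functor whose structure maps $\psi_0,\psi_{A,B}$ satisfy $\Phi(\mathrm{copy}_A)=\psi_{A,A}\circ\mathrm{copy}_{\Phi A}$, $\Phi(\mathrm{del}_A)=\psi_0\circ\mathrm{del}_{\Phi A}$; $\overline X=\Phi(X)$, $\overline f=\Phi(f)$. Imitation: for a preordered set $(X,\succeq)$ and relations $\nu,\mu\colon A\to X$, $\nu\succeq^{\rm im}\mu$ iff for every $a$ with $\mu(a)\ne\emptyset$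 there are functions $\mathrm{enh}\colon\mu(a)\to\nu(a)$ with $\mathrm{enh}(u)\succeq u$ and $\mathrm{deg}\colon\nu(a)\to\mu(a)$ with $v\succeq\mathrm{deg}(v)$. A target–context category with intrinsic behaviors: such $\mathcal{C}$ with objects $T,C,B$, a morphism $\mathrm{eval}\colon T\otimes C\to B$ with $\overline{\mathrm{eval}}$ a function, a lax gs-monoidal $\Phi$, a preorder $\succeq$ on $\overline B$; the ambient relation on $\mathcal{C}(A,T\otimes C)$ is $f\succeq g$ iff $\overline{\mathrm{eval}}\circ\overline f\succeq^{\rm im}\overline{\mathrm{eval}}\circ\overline g$, required to satisfy $f\circ\mathrm{dom}(g)=g\Rightarrow f\succeq g$ and $f\succeq g\Rightarrow f\circ h\succeq g\circ h$. A simulator with programs $P$ is $s\colon P\otimes C\to T\otimes C$ for which there are a functional $s_T\colon P\to T$ and $s_C\colon P\otimes C\to C$ with $s=(s_T\otimes s_C)\circ(\mathrm{copy}_P\otimes\mathrm{id}_C)$, $(\mathrm{id}_T\otimes\mathrm{del}_C)\circ s=s_T\otimes\mathrm{del}_C$, $(\mathrm{del}_T\otimes\mathrm{id}_C)\circ s=s_C$. It is universal if there is a functional $r\colon T\to P$ with $s\circ(r\otimes\mathrm{id}_C)\succeq\mathrm{id}_{T\otimes C}$. $F\colon P\otimes C\to B$ is an $A$-complete parametrization of maps $C\to B$ if for every $f\colon A\otimes C\to B$ there is a functional $p_f\colon A\to P$ with $\overline{F\circ(p_f\otimes\mathrm{id}_C)}\succeq^{\rm im}\overline f$. *)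

theory Defs
  imports "HOL-Library.FuncSet"
begin

section \<open>Gs-monoidal categories\<close>

text \<open>
  Morphisms carry their source and target, so the hom-sets are disjoint. Composition
  \<open>g \<cdot> f\<close> (first \<open>f\<close>) is a total function on the type of morphisms and is only meaningful
  for composable ones; likewise all other operations outside their carriers.
  The monoidal structure is not assumed to be strict.
\<close>

record ('o, 'm) gs_data =
  obj :: "'o set"
  arr :: "'m set"
  src :: "'m \<Rightarrow> 'o"
  tgt :: "'m \<Rightarrow> 'o"
  idn :: "'o \<Rightarrow> 'm"  ("\<iota>\<index>")
  cmp :: "'m \<Rightarrow> 'm \<Rightarrow> 'm"  (infixr "\<cdot>\<index>" 55)
  tobj :: "'o \<Rightarrow> 'o \<Rightarrow> 'o"  (infixr "\<otimes>\<index>" 70)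
  tarr :: "'m \<Rightarrow> 'm \<Rightarrow> 'm"  (infixr "\<odot>\<index>" 65)
  unit_obj :: 'o  ("\<I>\<index>")
  assoc :: "'o \<Rightarrow> 'o \<Rightarrow> 'o \<Rightarrow> 'm"  ("\<alpha>\<index>")
  lunit :: "'o \<Rightarrow> 'm"  ("\<lambda>\<^sub>l\<index>")
  runit :: "'o \<Rightarrow> 'm"  ("\<rho>\<index>")
  braid :: "'o \<Rightarrow> 'o \<Rightarrow> 'm"  ("\<sigma>\<index>")
  copy :: "'o \<Rightarrow> 'm"  ("copy\<index>")
  del :: "'o \<Rightarrow> 'm"  ("del\<index>")

definition Hom :: "('o, 'm, 'x) gs_data_scheme \<Rightarrow> 'o \<Rightarrow> 'o \<Rightarrow> 'm set" where
  "Hom \<C> X Y = {f \<in> arr \<C>. src \<C> f = X \<and> tgt \<C> f = Y}"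

locale category =
  fixes \<C> :: "('o, 'm, 'x) gs_data_scheme" (structure)
  assumes src_obj: "f \<in> arr \<C> \<Longrightarrow> src \<C> f \<in> obj \<C>"
    and tgt_obj: "f \<in> arr \<C> \<Longrightarrow> tgt \<C> f \<in> obj \<C>"
    and idn_hom: "X \<in> obj \<C> \<Longrightarrow> \<iota> X \<in> Hom \<C> X X"
    and cmp_hom: "\<lbrakk>f \<in> Hom \<C> X Y; g \<in> Hom \<C> Y Z\<rbrakk> \<Longrightarrow> g \<cdot> f \<in> Hom \<C> X Z"
    and cmp_idn_right: "f \<in> Hom \<C> X Y \<Longrightarrow> f \<cdot> \<iota> X = f"
    and cmp_idn_left: "f \<in> Hom \<C> X Y \<Longrightarrow> \<iota> Y \<cdot> f = f"
    and cmp_assoc: "\<lbrakk>f \<in> Hom \<C> W X; g \<in> Hom \<C> X Y; h \<in> Hom \<C> Y Z\<rbrakk>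
      \<Longrightarrow> (h \<cdot> g) \<cdot> f = h \<cdot> (g \<cdot> f)"

definition inverse_arrows :: "('o, 'm, 'x) gs_data_scheme \<Rightarrow> 'm \<Rightarrow> 'm \<Rightarrow> bool" where
  "inverse_arrows \<C> f g \<longleftrightarrow>
     f \<in> arr \<C> \<and> g \<in> Hom \<C> (tgt \<C> f) (src \<C> f) \<and>
     g \<cdot> f = \<iota> (src \<C> f) \<and> f \<cdot> g = \<iota> (tgt \<C> f)"
  for \<C> (structure)

definition is_iso :: "('o, 'm, 'x) gs_data_scheme \<Rightarrow> 'm \<Rightarrow> bool" where
  "is_iso \<C> f \<longleftrightarrow> (\<exists>g. inverse_arrows \<C> f g)"

definition inv_arr :: "('o, 'm, 'x) gs_data_scheme \<Rightarrow> 'm \<Rightarrow> 'm" where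
  "inv_arr \<C> f = (THE g. inverse_arrows \<C> f g)"

locale symmetric_monoidal_category = category +
  assumes unit_obj: "\<I> \<in> obj \<C>"
    and tobj_obj: "\<lbrakk>X \<in> obj \<C>; Y \<in> obj \<C>\<rbrakk> \<Longrightarrow> X \<otimes> Y \<in> obj \<C>"
    and tarr_hom: "\<lbrakk>f \<in> Hom \<C> X X'; g \<in> Hom \<C> Y Y'\<rbrakk> \<Longrightarrow> f \<odot> g \<in> Hom \<C> (X \<otimes> Y) (X' \<otimes> Y')"
    and tarr_idn: "\<lbrakk>X \<in> obj \<C>; Y \<in> obj \<C>\<rbrakk> \<Longrightarrow> \<iota> X \<odot> \<iota> Y = \<iota> (X \<otimes> Y)"
    and tarr_cmp: "\<lbrakk>f \<in> Hom \<C> X X'; f' \<in> Hom \<C> X' X''; g \<in> Hom \<C> Y Y'; g' \<in> Hom \<C> Y' Y''\<rbrakk>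
      \<Longrightarrow> (f' \<cdot> f) \<odot> (g' \<cdot> g) = (f' \<odot> g') \<cdot> (f \<odot> g)"
    and assoc_hom: "\<lbrakk>X \<in> obj \<C>; Y \<in> obj \<C>; Z \<in> obj \<C>\<rbrakk>
      \<Longrightarrow> \<alpha> X Y Z \<in> Hom \<C> ((X \<otimes> Y) \<otimes> Z) (X \<otimes> (Y \<otimes> Z))"
    and assoc_iso: "\<lbrakk>X \<in> obj \<C>; Y \<in> obj \<C>; Z \<in> obj \<C>\<rbrakk> \<Longrightarrow> is_iso \<C> (\<alpha> X Y Z)"
    and assoc_natural: "\<lbrakk>f \<in> Hom \<C> X X'; g \<in> Hom \<C> Y Y'; h \<in> Hom \<C> Z Z'\<rbrakk>
      \<Longrightarrow> \<alpha> X' Y' Z' \<cdot> ((f \<odot> g) \<odot> h) = (f \<odot> (g \<odot> h)) \<cdot> \<alpha> X Y Z"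
    and lunit_hom: "X \<in> obj \<C> \<Longrightarrow> \<lambda>\<^sub>l X \<in> Hom \<C> (\<I> \<otimes> X) X"
    and lunit_iso: "X \<in> obj \<C> \<Longrightarrow> is_iso \<C> (\<lambda>\<^sub>l X)"
    and lunit_natural: "f \<in> Hom \<C> X X' \<Longrightarrow> \<lambda>\<^sub>l X' \<cdot> (\<iota> \<I> \<odot> f) = f \<cdot> \<lambda>\<^sub>l X"
    and runit_hom: "X \<in> obj \<C> \<Longrightarrow> \<rho> X \<in> Hom \<C> (X \<otimes> \<I>) X"
    and runit_iso: "X \<in> obj \<C> \<Longrightarrow> is_iso \<C> (\<rho> X)"
    and runit_natural: "f \<in> Hom \<C> X X' \<Longrightarrow> \<rho> X' \<cdot> (f \<odot> \<iota> \<I>) = f \<cdot> \<rho> X"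
    and braid_hom: "\<lbrakk>X \<in> obj \<C>; Y \<in> obj \<C>\<rbrakk> \<Longrightarrow> \<sigma> X Y \<in> Hom \<C> (X \<otimes> Y) (Y \<otimes> X)"
    and braid_natural: "\<lbrakk>f \<in> Hom \<C> X X'; g \<in> Hom \<C> Y Y'\<rbrakk>
      \<Longrightarrow> \<sigma> X' Y' \<cdot> (f \<odot> g) = (g \<odot> f) \<cdot> \<sigma> X Y"
    and pentagon: "\<lbrakk>W \<in> obj \<C>; X \<in> obj \<C>; Y \<in> obj \<C>; Z \<in> obj \<C>\<rbrakk>
      \<Longrightarrow> \<alpha> W X (Y \<otimes> Z) \<cdot> \<alpha> (W \<otimes> X) Y Z
        = (\<iota> W \<odot> \<alpha> X Y Z) \<cdot> \<alpha> W (X \<otimes> Y) Z \<cdot> (\<alpha> W X Y \<odot> \<iota> Z)"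
    and triangle: "\<lbrakk>X \<in> obj \<C>; Y \<in> obj \<C>\<rbrakk>
      \<Longrightarrow> (\<iota> X \<odot> \<lambda>\<^sub>l Y) \<cdot> \<alpha> X \<I> Y = \<rho> X \<odot> \<iota> Y"
    and braid_inverse: "\<lbrakk>X \<in> obj \<C>; Y \<in> obj \<C>\<rbrakk> \<Longrightarrow> \<sigma> Y X \<cdot> \<sigma> X Y = \<iota> (X \<otimes> Y)"
    and hexagon: "\<lbrakk>X \<in> obj \<C>; Y \<in> obj \<C>; Z \<in> obj \<C>\<rbrakk>
      \<Longrightarrow> \<alpha> Y Z X \<cdot> \<sigma> X (Y \<otimes> Z) \<cdot> \<alpha> X Y Z
        = (\<iota> Y \<odot> \<sigma> X Z) \<cdot> \<alpha> Y X Z \<cdot> (\<sigma> X Y \<odot> \<iota> Z)"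

text \<open>The canonical isomorphism \<open>(X \<otimes> X) \<otimes> (Y \<otimes> Y) \<rightarrow> (X \<otimes> Y) \<otimes> (X \<otimes> Y)\<close>
  exchanging the two middle factors.\<close>

definition mid_swap :: "('o, 'm, 'x) gs_data_scheme \<Rightarrow> 'o \<Rightarrow> 'o \<Rightarrow> 'm" where
  "mid_swap \<C> X Y =
     inv_arr \<C> (\<alpha> X Y (X \<otimes> Y)) \<cdot> (\<iota> X \<odot> \<alpha> Y X Y) \<cdot> (\<iota> X \<odot> (\<sigma> X Y \<odot> \<iota> Y))
       \<cdot> (\<iota> X \<odot> inv_arr \<C> (\<alpha> X Y Y)) \<cdot> \<alpha> X X (Y \<otimes> Y)"
  for \<C> (structure)

locale gs_monoidal_category = symmetric_monoidal_category +
  assumes copy_hom: "X \<in> obj \<C> \<Longrightarrow> copy X \<in> Hom \<C> X (X \<otimes> X)"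
    and del_hom: "X \<in> obj \<C> \<Longrightarrow> del X \<in> Hom \<C> X \<I>"
    and copy_assoc: "X \<in> obj \<C>
      \<Longrightarrow> \<alpha> X X X \<cdot> (copy X \<odot> \<iota> X) \<cdot> copy X = (\<iota> X \<odot> copy X) \<cdot> copy X"
    and copy_counit_left: "X \<in> obj \<C> \<Longrightarrow> \<lambda>\<^sub>l X \<cdot> (del X \<odot> \<iota> X) \<cdot> copy X = \<iota> X"
    and copy_counit_right: "X \<in> obj \<C> \<Longrightarrow> \<rho> X \<cdot> (\<iota> X \<odot> del X) \<cdot> copy X = \<iota> X"
    and copy_commute: "X \<in> obj \<C> \<Longrightarrow> \<sigma> X X \<cdot> copy X = copy X"
    and copy_tensor: "\<lbrakk>X \<in> obj \<C>; Y \<in> obj \<C>\<rbrakk>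
      \<Longrightarrow> copy (X \<otimes> Y) = mid_swap \<C> X Y \<cdot> (copy X \<odot> copy Y)"
    and del_tensor: "\<lbrakk>X \<in> obj \<C>; Y \<in> obj \<C>\<rbrakk>
      \<Longrightarrow> del (X \<otimes> Y) = \<lambda>\<^sub>l \<I> \<cdot> (del X \<odot> del Y)"
    and del_unit: "del \<I> = \<iota> \<I>"

text \<open>The domain of \<open>f : A \<rightarrow> X\<close> is an endomorphism of \<open>A\<close>; the right unitor identifies
  \<open>A \<otimes> I\<close> with \<open>A\<close>.\<close>

definition dom_arr :: "('o, 'm, 'x) gs_data_scheme \<Rightarrow> 'm \<Rightarrow> 'm" where
  "dom_arr \<C> f =
     \<rho> (src \<C> f) \<cdot> (\<iota> (src \<C> f) \<odot> (del (tgt \<C> f) \<cdot> f)) \<cdot> copy (src \<C> f)"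
  for \<C> (structure)

definition normalized :: "('o, 'm, 'x) gs_data_scheme \<Rightarrow> 'm \<Rightarrow> bool" where
  "normalized \<C> f \<longleftrightarrow> f \<cdot> dom_arr \<C> f = f"
  for \<C> (structure)

definition functional :: "('o, 'm, 'x) gs_data_scheme \<Rightarrow> 'm \<Rightarrow> bool" where
  "functional \<C> f \<longleftrightarrow> copy (tgt \<C> f) \<cdot> f = (f \<odot> f) \<cdot> copy (src \<C> f)"
  for \<C> (structure)

locale normalized_gs_monoidal_category = gs_monoidal_category +
  assumes all_normalized: "f \<in> arr \<C> \<Longrightarrow> normalized \<C> f"


section \<open>Lax gs-monoidal functors to \<open>Rel\<close>\<close>

text \<open>
  A relation \<open>X \<rightarrow> Y\<close> is a subset of \<open>X \<times> Y\<close>. Library relation composition is diagrammatic: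
  \<open>R O S\<close> is \<open>S \<circ> R\<close> in the category of relations. Its tensor is the cartesian product, its
  unit the one-element set \<open>UNIV :: unit set\<close>; the following are its structure maps.
\<close>

definition rel_tensor :: "('a \<times> 'b) set \<Rightarrow> ('c \<times> 'd) set \<Rightarrow> (('a \<times> 'c) \<times> ('b \<times> 'd)) set" where
  "rel_tensor R S = {((a, c), (b, d)) | a b c d. (a, b) \<in> R \<and> (c, d) \<in> S}"

definition rel_assoc ::
  "'a set \<Rightarrow> 'b set \<Rightarrow> 'c set \<Rightarrow> ((('a \<times> 'b) \<times> 'c) \<times> ('a \<times> ('b \<times> 'c))) set" where
  "rel_assoc X Y Z = {(((x, y), z), (x, (y, z))) | x y z. x \<in> X \<and> y \<in> Y \<and> z \<in> Z}"

definition rel_lunit :: "'a set \<Rightarrow> ((unit \<times> 'a) \<times> 'a) set" where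
  "rel_lunit X = {(((), x), x) | x. x \<in> X}"

definition rel_runit :: "'a set \<Rightarrow> (('a \<times> unit) \<times> 'a) set" where
  "rel_runit X = {((x, ()), x) | x. x \<in> X}"

definition rel_braid :: "'a set \<Rightarrow> 'b set \<Rightarrow> (('a \<times> 'b) \<times> ('b \<times> 'a)) set" where
  "rel_braid X Y = {((x, y), (y, x)) | x y. x \<in> X \<and> y \<in> Y}"

definition rel_copy :: "'a set \<Rightarrow> ('a \<times> ('a \<times> 'a)) set" where
  "rel_copy X = {(x, (x, x)) | x. x \<in> X}"

definition rel_del :: "'a set \<Rightarrow> ('a \<times> unit) set" where
  "rel_del X = {(x, ()) | x. x \<in> X}"

text \<open>The sets \<open>\<Phi> X\<close> are subsets of a common type \<open>'v\<close>, which is arbitrary.\<close>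

record ('o, 'm, 'v) rel_functor =
  fobj :: "'o \<Rightarrow> 'v set"
  farr :: "'m \<Rightarrow> ('v \<times> 'v) set"
  psi0 :: "(unit \<times> 'v) set"
  psi :: "'o \<Rightarrow> 'o \<Rightarrow> (('v \<times> 'v) \<times> 'v) set"

locale functor_to_Rel = category \<C>
  for \<C> :: "('o, 'm, 'x) gs_data_scheme" (structure) +
  fixes \<Phi> :: "('o, 'm, 'v, 'y) rel_functor_scheme"
  assumes farr_rel: "f \<in> Hom \<C> X Y \<Longrightarrow> farr \<Phi> f \<subseteq> fobj \<Phi> X \<times> fobj \<Phi> Y"
    and farr_idn: "X \<in> obj \<C> \<Longrightarrow> farr \<Phi> (\<iota> X) = Id_on (fobj \<Phi> X)"
    and farr_cmp: "\<lbrakk>f \<in> Hom \<C> X Y; g \<in> Hom \<C> Y Z\<rbrakk> \<Longrightarrow> farr \<Phi> (g \<cdot> f) = farr \<Phi> f O farr \<Phi> g"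

locale lax_symmetric_monoidal_functor_to_Rel =
  symmetric_monoidal_category \<C> + functor_to_Rel \<C> \<Phi>
  for \<C> :: "('o, 'm, 'x) gs_data_scheme" (structure)
    and \<Phi> :: "('o, 'm, 'v, 'y) rel_functor_scheme" +
  assumes psi0_rel: "psi0 \<Phi> \<subseteq> UNIV \<times> fobj \<Phi> \<I>"
    and psi_rel: "\<lbrakk>X \<in> obj \<C>; Y \<in> obj \<C>\<rbrakk>
      \<Longrightarrow> psi \<Phi> X Y \<subseteq> (fobj \<Phi> X \<times> fobj \<Phi> Y) \<times> fobj \<Phi> (X \<otimes> Y)"
    and psi_natural: "\<lbrakk>f \<in> Hom \<C> X X'; g \<in> Hom \<C> Y Y'\<rbrakk>
      \<Longrightarrow> psi \<Phi> X Y O farr \<Phi> (f \<odot> g) = rel_tensor (farr \<Phi> f) (farr \<Phi> g) O psi \<Phi> X' Y'"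
    and psi_assoc: "\<lbrakk>X \<in> obj \<C>; Y \<in> obj \<C>; Z \<in> obj \<C>\<rbrakk>
      \<Longrightarrow> rel_tensor (psi \<Phi> X Y) (Id_on (fobj \<Phi> Z)) O psi \<Phi> (X \<otimes> Y) Z O farr \<Phi> (\<alpha> X Y Z)
        = rel_assoc (fobj \<Phi> X) (fobj \<Phi> Y) (fobj \<Phi> Z)
            O rel_tensor (Id_on (fobj \<Phi> X)) (psi \<Phi> Y Z) O psi \<Phi> X (Y \<otimes> Z)"
    and psi_lunit: "X \<in> obj \<C>
      \<Longrightarrow> rel_tensor (psi0 \<Phi>) (Id_on (fobj \<Phi> X)) O psi \<Phi> \<I> X O farr \<Phi> (\<lambda>\<^sub>l X)
        = rel_lunit (fobj \<Phi> X)"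
    and psi_runit: "X \<in> obj \<C>
      \<Longrightarrow> rel_tensor (Id_on (fobj \<Phi> X)) (psi0 \<Phi>) O psi \<Phi> X \<I> O farr \<Phi> (\<rho> X)
        = rel_runit (fobj \<Phi> X)"
    and psi_braid: "\<lbrakk>X \<in> obj \<C>; Y \<in> obj \<C>\<rbrakk>
      \<Longrightarrow> psi \<Phi> X Y O farr \<Phi> (\<sigma> X Y) = rel_braid (fobj \<Phi> X) (fobj \<Phi> Y) O psi \<Phi> Y X"

locale lax_gs_monoidal_functor_to_Rel =
  gs_monoidal_category \<C> + lax_symmetric_monoidal_functor_to_Rel \<C> \<Phi>
  for \<C> :: "('o, 'm, 'x) gs_data_scheme" (structure)
    and \<Phi> :: "('o, 'm, 'v, 'y) rel_functor_scheme" +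
  assumes farr_copy: "X \<in> obj \<C> \<Longrightarrow> farr \<Phi> (copy X) = rel_copy (fobj \<Phi> X) O psi \<Phi> X X"
    and farr_del: "X \<in> obj \<C> \<Longrightarrow> farr \<Phi> (del X) = rel_del (fobj \<Phi> X) O psi0 \<Phi>"


section \<open>Target--context categories with intrinsic behaviors\<close>

text \<open>\<open>geq x y\<close> stands for \<open>x \<succeq> y\<close>. For relations \<open>\<nu>\<close> and \<open>\<mu>\<close> out of \<open>A\<close>,
  \<open>imitates A geq \<nu> \<mu>\<close> is \<open>\<nu> \<succeq>\<^sup>i\<^sup>m \<mu>\<close>.\<close>

definition imitates ::
  "'a set \<Rightarrow> ('v \<Rightarrow> 'v \<Rightarrow> bool) \<Rightarrow> ('a \<times> 'v) set \<Rightarrow> ('a \<times> 'v) set \<Rightarrow> bool" where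
  "imitates A geq \<nu> \<mu> \<longleftrightarrow>
     (\<forall>a\<in>A. \<mu> `` {a} \<noteq> {} \<longrightarrow>
        (\<exists>enh \<in> \<mu> `` {a} \<rightarrow> \<nu> `` {a}. \<forall>u \<in> \<mu> `` {a}. geq (enh u) u) \<and>
        (\<exists>deg \<in> \<nu> `` {a} \<rightarrow> \<mu> `` {a}. \<forall>v \<in> \<nu> `` {a}. geq v (deg v)))"

text \<open>The ambient relation \<open>f \<succeq> g\<close> for \<open>f, g : A \<rightarrow> T \<otimes> C\<close>.\<close>

definition ambient_geq ::
  "('o, 'm, 'v, 'y) rel_functor_scheme \<Rightarrow> ('v \<Rightarrow> 'v \<Rightarrow> bool) \<Rightarrow> 'm \<Rightarrow> 'o \<Rightarrow> 'm \<Rightarrow> 'm \<Rightarrow> bool" where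
  "ambient_geq \<Phi> geq ev A f g \<longleftrightarrow>
     imitates (fobj \<Phi> A) geq (farr \<Phi> f O farr \<Phi> ev) (farr \<Phi> g O farr \<Phi> ev)"

locale target_context_category_intrinsic =
  normalized_gs_monoidal_category \<C> + lax_gs_monoidal_functor_to_Rel \<C> \<Phi>
  for \<C> :: "('o, 'm, 'x) gs_data_scheme" (structure)
    and \<Phi> :: "('o, 'm, 'v, 'y) rel_functor_scheme" +
  fixes T C B :: 'o
    and ev :: 'm
    and geq :: "'v \<Rightarrow> 'v \<Rightarrow> bool"
  assumes T_obj: "T \<in> obj \<C>"
    and C_obj: "C \<in> obj \<C>"
    and B_obj: "B \<in> obj \<C>"
    and ev_hom: "ev \<in> Hom \<C> (T \<otimes> C) B"
    and ev_function: "x \<in> fobj \<Phi> (T \<otimes> C) \<Longrightarrow> \<exists>!y. (x, y) \<in> farr \<Phi> ev"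
    and geq_refl: "reflp_on (fobj \<Phi> B) geq"
    and geq_trans: "transp_on (fobj \<Phi> B) geq"
    and ambient_dom: "\<lbrakk>f \<in> Hom \<C> X (T \<otimes> C); g \<in> Hom \<C> X (T \<otimes> C); f \<cdot> dom_arr \<C> g = g\<rbrakk>
      \<Longrightarrow> ambient_geq \<Phi> geq ev X f g"
    and ambient_precomp: "\<lbrakk>f \<in> Hom \<C> X (T \<otimes> C); g \<in> Hom \<C> X (T \<otimes> C); h \<in> Hom \<C> Z X;
        ambient_geq \<Phi> geq ev X f g\<rbrakk>
      \<Longrightarrow> ambient_geq \<Phi> geq ev Z (f \<cdot> h) (g \<cdot> h)"

text \<open>The associator mediates between \<open>copy P \<odot> \<iota> C : P \<otimes> C \<rightarrow> (P \<otimes> P) \<otimes> C\<close> and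
  \<open>s_T \<odot> s_C : P \<otimes> (P \<otimes> C) \<rightarrow> T \<otimes> C\<close>; the left unitor identifies \<open>I \<otimes> C\<close> with \<open>C\<close>.\<close>

definition simulator ::
  "('o, 'm, 'x) gs_data_scheme \<Rightarrow> 'o \<Rightarrow> 'o \<Rightarrow> 'o \<Rightarrow> 'm \<Rightarrow> bool" where
  "simulator \<C> T C P s \<longleftrightarrow>
     P \<in> obj \<C> \<and> s \<in> Hom \<C> (P \<otimes> C) (T \<otimes> C) \<and>
     (\<exists>s_T \<in> Hom \<C> P T. \<exists>s_C \<in> Hom \<C> (P \<otimes> C) C.
        functional \<C> s_T \<and>
        s = (s_T \<odot> s_C) \<cdot> \<alpha> P P C \<cdot> (copy P \<odot> \<iota> C) \<and>
        (\<iota> T \<odot> del C) \<cdot> s = s_T \<odot> del C \<and>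
        \<lambda>\<^sub>l C \<cdot> (del T \<odot> \<iota> C) \<cdot> s = s_C)"
  for \<C> (structure)

definition universal_simulator ::
  "('o, 'm, 'x) gs_data_scheme \<Rightarrow> ('o, 'm, 'v, 'y) rel_functor_scheme \<Rightarrow> 'o \<Rightarrow> 'o
    \<Rightarrow> 'm \<Rightarrow> ('v \<Rightarrow> 'v \<Rightarrow> bool) \<Rightarrow> 'o \<Rightarrow> 'm \<Rightarrow> bool" where
  "universal_simulator \<C> \<Phi> T C ev geq P s \<longleftrightarrow>
     simulator \<C> T C P s \<and>
     (\<exists>r \<in> Hom \<C> T P. functional \<C> r \<and>
        ambient_geq \<Phi> geq ev (T \<otimes> C) (s \<cdot> (r \<odot> \<iota> C)) (\<iota> (T \<otimes> C)))"
  for \<C> (structure)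

definition complete_parametrization ::
  "('o, 'm, 'x) gs_data_scheme \<Rightarrow> ('o, 'm, 'v, 'y) rel_functor_scheme \<Rightarrow> 'o \<Rightarrow> 'o
    \<Rightarrow> ('v \<Rightarrow> 'v \<Rightarrow> bool) \<Rightarrow> 'o \<Rightarrow> 'o \<Rightarrow> 'm \<Rightarrow> bool" where
  "complete_parametrization \<C> \<Phi> C B geq A P F \<longleftrightarrow>
     F \<in> Hom \<C> (P \<otimes> C) B \<and>
     (\<forall>f \<in> Hom \<C> (A \<otimes> C) B. \<exists>p \<in> Hom \<C> A P. functional \<C> p \<and>
        imitates (fobj \<Phi> (A \<otimes> C)) geq (farr \<Phi> (F \<cdot> (p \<odot> \<iota> C))) (farr \<Phi> f))"
  for \<C> (structure)

definition quasi_fixed_point ::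
  "('o, 'm, 'x) gs_data_scheme \<Rightarrow> ('o, 'm, 'v, 'y) rel_functor_scheme \<Rightarrow> 'o
    \<Rightarrow> ('v \<Rightarrow> 'v \<Rightarrow> bool) \<Rightarrow> 'm \<Rightarrow> 'm \<Rightarrow> bool" where
  "quasi_fixed_point \<C> \<Phi> B geq g b \<longleftrightarrow>
     b \<in> arr \<C> \<and> tgt \<C> b = B \<and>
     imitates (fobj \<Phi> (src \<C> b)) geq (farr \<Phi> b) (farr \<Phi> b O farr \<Phi> g)"

end

theory Submission
  imports Defs
begin

text \<open>
  Lawvere's diagonal argument. Put \<open>F = eval \<circ> s\<close>, let \<open>\<pi> : A \<otimes> C \<rightarrow> C\<close> delete \<open>A\<close>, and
  parametrize \<open>f = g \<circ> F \<circ> copy\<^sub>C \<circ> \<pi>\<close> by \<open>p : A \<rightarrow> T\<close>. With \<open>q = r \<circ> p\<close>, universality of \<open>s\<close>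
  gives \<open>F \<circ> (q \<otimes> id) \<succeq> f\<close>. Precomposing with \<open>h = (id \<otimes> q) \<circ> copy\<^sub>A\<close> turns the left side into
  \<open>b = F \<circ> copy\<^sub>C \<circ> q\<close> (as \<open>q\<close> is functional) and the right side into \<open>g \<circ> b\<close>.

  Imitation is not stable under precomposition with arbitrary relations: \<open>deg\<close> is lost when
  \<open>\<mu>\<close> is empty on some but not all values of the inner relation. Here this does not happen: the
  image of \<open>q\<close> is single-valued, the image of \<open>\<pi>\<close> is total, and \<open>\<pi> \<circ> h = q\<close>, so all values of
  \<open>h\<close> at a point have the same image under \<open>\<pi>\<close>, hence under \<open>f\<close>.
\<close>

section \<open>Imitation\<close>

text \<open>The axiom of choice, applied on each image set, trades the functions \<open>enh\<close>
  and \<open>deg\<close> for pointwise existence.\<close>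

lemma imitates_iff:
  "imitates A geq \<nu> \<mu> \<longleftrightarrow>
     (\<forall>a\<in>A. \<mu> `` {a} \<noteq> {} \<longrightarrow>
        (\<forall>u \<in> \<mu> `` {a}. \<exists>v \<in> \<nu> `` {a}. geq v u) \<and> (\<forall>v \<in> \<nu> `` {a}. \<exists>u \<in> \<mu> `` {a}. geq v u))"
proof -
  have "(\<exists>e \<in> S \<rightarrow> R. \<forall>x \<in> S. P x (e x)) \<longleftrightarrow> (\<forall>x \<in> S. \<exists>y \<in> R. P x y)"
    for S :: "'b set" and R and P :: "'b \<Rightarrow> 'b \<Rightarrow> bool"
    using bchoice[of S "\<lambda>x y. y \<in> R \<and> P x y"] by blast
  from this[where P = "\<lambda>x y. geq y x"] this[where P = geq]
  show ?thesis unfolding imitates_def by simp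
qed

text \<open>Witnesses chain through \<open>\<mu>\<close>, whose image at \<open>a\<close> is
  nonempty because enhancing a value of \<open>\<kappa>\<close> lands there. The inclusions keep all
  values in \<open>Y\<close>, where \<open>geq\<close> is transitive.\<close>

lemma imitates_trans:
  assumes "transp_on Y geq" and "\<nu> \<subseteq> A \<times> Y" "\<mu> \<subseteq> A \<times> Y" "\<kappa> \<subseteq> A \<times> Y"
    and "imitates A geq \<nu> \<mu>" and "imitates A geq \<mu> \<kappa>"
  shows "imitates A geq \<nu> \<kappa>"
  unfolding imitates_iff
proof (intro ballI impI conjI)
  have tr: "geq x z" if "geq x y" "geq y z" "x \<in> Y" "y \<in> Y" "z \<in> Y" for x y z
    using assms(1) that by (meson transp_onD)
  fix a assume a: "a \<in> A" "\<kappa> `` {a} \<noteq> {}"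
  have \<kappa>: "\<forall>u \<in> \<kappa> `` {a}. \<exists>v \<in> \<mu> `` {a}. geq v u" "\<forall>v \<in> \<mu> `` {a}. \<exists>u \<in> \<kappa> `` {a}. geq v u"
    using assms(6) a unfolding imitates_iff by blast+
  with a(2) have "\<mu> `` {a} \<noteq> {}" by blast
  then have \<mu>: "\<forall>u \<in> \<mu> `` {a}. \<exists>v \<in> \<nu> `` {a}. geq v u" "\<forall>v \<in> \<nu> `` {a}. \<exists>u \<in> \<mu> `` {a}. geq v u"
    using assms(5) a unfolding imitates_iff by blast+
  have Y: "\<nu> `` {a} \<subseteq> Y" "\<mu> `` {a} \<subseteq> Y" "\<kappa> `` {a} \<subseteq> Y" using assms(2-4) by auto
  show "\<exists>v \<in> \<nu> `` {a}. geq v u" if "u \<in> \<kappa> `` {a}" for u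
    using \<kappa>(1) \<mu>(1) Y tr that by (meson subsetD)
  show "\<exists>u \<in> \<kappa> `` {a}. geq v u" if "v \<in> \<nu> `` {a}" for v
    using \<kappa>(2) \<mu>(2) Y tr that by (meson subsetD)
qed

text \<open>By \<open>nonempty\<close>, if \<open>\<mu>\<close> is defined at one value of
  \<open>h\<close> at \<open>a\<close>, it is defined at all of them, so both halves of imitation
  apply at each value and pass to the unions.\<close>

lemma imitates_precomp:
  assumes "imitates X geq \<nu> \<mu>" and "h \<subseteq> A \<times> X"
    and nonempty: "\<And>a x x'. (a, x) \<in> h \<Longrightarrow> (a, x') \<in> h \<Longrightarrow> \<mu> `` {x} \<noteq> {} \<Longrightarrow> \<mu> `` {x'} \<noteq> {}"
  shows "imitates A geq (h O \<nu>) (h O \<mu>)"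
  unfolding imitates_iff
proof (intro ballI impI)
  fix a assume "a \<in> A" and "(h O \<mu>) `` {a} \<noteq> {}"
  then obtain x where "(a, x) \<in> h" "\<mu> `` {x} \<noteq> {}" by blast
  then have "x' \<in> X \<and> \<mu> `` {x'} \<noteq> {}" if "(a, x') \<in> h" for x'
    using nonempty that assms(2) by blast
  then have "(\<forall>u \<in> \<mu> `` {x'}. \<exists>v \<in> \<nu> `` {x'}. geq v u) \<and> (\<forall>v \<in> \<nu> `` {x'}. \<exists>u \<in> \<mu> `` {x'}. geq v u)"
    if "(a, x') \<in> h" for x'
    using that assms(1) unfolding imitates_iff by meson
  then show "(\<forall>u \<in> (h O \<mu>) `` {a}. \<exists>v \<in> (h O \<nu>) `` {a}. geq v u) \<and>
      (\<forall>v \<in> (h O \<nu>) `` {a}. \<exists>u \<in> (h O \<mu>) `` {a}. geq v u)"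
    by blast
qed


section \<open>Projections and functional morphisms\<close>

definition snd_proj :: "('o, 'm, 'x) gs_data_scheme \<Rightarrow> 'o \<Rightarrow> 'o \<Rightarrow> 'm" where
  "snd_proj \<C> X Y = \<lambda>\<^sub>l Y \<cdot> (del X \<odot> \<iota> Y)"
  for \<C> (structure)

context gs_monoidal_category
begin

lemma snd_proj_hom: "\<lbrakk>X \<in> obj \<C>; Y \<in> obj \<C>\<rbrakk> \<Longrightarrow> snd_proj \<C> X Y \<in> Hom \<C> (X \<otimes> Y) Y"
  unfolding snd_proj_def by (meson cmp_hom tarr_hom del_hom idn_hom lunit_hom)

lemma tarr_split_left:
  assumes "f \<in> Hom \<C> X X'" "g \<in> Hom \<C> Y Y'"
    and "X \<in> obj \<C>" "X' \<in> obj \<C>" "Y \<in> obj \<C>" "Y' \<in> obj \<C>"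
  shows "f \<odot> g = (f \<odot> \<iota> Y') \<cdot> (\<iota> X \<odot> g)"
  using tarr_cmp[OF idn_hom[OF assms(3)] assms(1) assms(2) idn_hom[OF assms(6)]]
    cmp_idn_left cmp_idn_right assms by simp

lemma tarr_split_right:
  assumes "f \<in> Hom \<C> X X'" "g \<in> Hom \<C> Y Y'"
    and "X \<in> obj \<C>" "X' \<in> obj \<C>" "Y \<in> obj \<C>" "Y' \<in> obj \<C>"
  shows "f \<odot> g = (\<iota> X' \<odot> g) \<cdot> (f \<odot> \<iota> Y)"
  using tarr_cmp[OF assms(1) idn_hom[OF assms(4)] idn_hom[OF assms(5)] assms(2)]
    cmp_idn_left cmp_idn_right assms by simp

lemma snd_proj_natural:
  assumes "g \<in> Hom \<C> Y Y'" and X: "X \<in> obj \<C>" and Y: "Y \<in> obj \<C>" "Y' \<in> obj \<C>"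
  shows "snd_proj \<C> X Y' \<cdot> (\<iota> X \<odot> g) = g \<cdot> snd_proj \<C> X Y"
proof -
  note homs = del_hom[OF X] idn_hom[OF unit_obj] idn_hom[OF X] idn_hom[OF Y(1)] idn_hom[OF Y(2)]
    lunit_hom[OF Y(1)] lunit_hom[OF Y(2)] assms(1)
  have "snd_proj \<C> X Y' \<cdot> (\<iota> X \<odot> g) = \<lambda>\<^sub>l Y' \<cdot> ((del X \<odot> \<iota> Y') \<cdot> (\<iota> X \<odot> g))"
    unfolding snd_proj_def by (rule cmp_assoc) (rule tarr_hom homs)+
  also have "(del X \<odot> \<iota> Y') \<cdot> (\<iota> X \<odot> g) = (\<iota> \<I> \<odot> g) \<cdot> (del X \<odot> \<iota> Y)"
    using tarr_split_left[OF homs(1) assms(1)] tarr_split_right[OF homs(1) assms(1)]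
      X Y unit_obj by simp
  also have "\<lambda>\<^sub>l Y' \<cdot> ((\<iota> \<I> \<odot> g) \<cdot> (del X \<odot> \<iota> Y)) = (\<lambda>\<^sub>l Y' \<cdot> (\<iota> \<I> \<odot> g)) \<cdot> (del X \<odot> \<iota> Y)"
    by (rule cmp_assoc[symmetric]) (rule tarr_hom homs)+
  also have "\<dots> = (g \<cdot> \<lambda>\<^sub>l Y) \<cdot> (del X \<odot> \<iota> Y)"
    by (simp only: lunit_natural[OF assms(1)])
  also have "\<dots> = g \<cdot> snd_proj \<C> X Y"
    unfolding snd_proj_def by (rule cmp_assoc) (rule tarr_hom homs)+
  finally show ?thesis .
qed

text \<open>Factoring \<open>del\<close> through the projection lets totality of the image of
  \<open>del\<close> pass to the image of \<open>snd_proj\<close>.\<close>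

lemma del_tensor_snd_proj:
  assumes X: "X \<in> obj \<C>" and Y: "Y \<in> obj \<C>"
  shows "del (X \<otimes> Y) = del Y \<cdot> snd_proj \<C> X Y"
proof -
  note homs = del_hom[OF X] del_hom[OF Y] idn_hom[OF unit_obj] idn_hom[OF Y]
    lunit_hom[OF Y] lunit_hom[OF unit_obj]
  have "del (X \<otimes> Y) = \<lambda>\<^sub>l \<I> \<cdot> ((\<iota> \<I> \<odot> del Y) \<cdot> (del X \<odot> \<iota> Y))"
    using del_tensor[OF X Y] tarr_split_right[OF homs(1,2)] X Y unit_obj by simp
  also have "\<dots> = (\<lambda>\<^sub>l \<I> \<cdot> (\<iota> \<I> \<odot> del Y)) \<cdot> (del X \<odot> \<iota> Y)"
    by (rule cmp_assoc[symmetric]) (rule tarr_hom homs)+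
  also have "\<dots> = (del Y \<cdot> \<lambda>\<^sub>l Y) \<cdot> (del X \<odot> \<iota> Y)"
    by (simp only: lunit_natural[OF homs(2)])
  also have "\<dots> = del Y \<cdot> snd_proj \<C> X Y"
    unfolding snd_proj_def by (rule cmp_assoc) (rule tarr_hom homs)+
  finally show ?thesis .
qed

lemma snd_proj_copy: "X \<in> obj \<C> \<Longrightarrow> snd_proj \<C> X X \<cdot> copy X = \<iota> X"
  unfolding snd_proj_def
  using copy_counit_left cmp_assoc[OF copy_hom tarr_hom[OF del_hom idn_hom] lunit_hom] by simp

lemma functional_eq:
  "f \<in> Hom \<C> X Y \<Longrightarrow> functional \<C> f \<longleftrightarrow> copy Y \<cdot> f = (f \<odot> f) \<cdot> copy X"
  unfolding functional_def Hom_def by auto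

lemma functional_cmp:
  assumes f: "f \<in> Hom \<C> X Y" "functional \<C> f" and g: "g \<in> Hom \<C> Y Z" "functional \<C> g"
    and X: "X \<in> obj \<C>" and Y: "Y \<in> obj \<C>" and Z: "Z \<in> obj \<C>"
  shows "functional \<C> (g \<cdot> f)"
proof -
  note homs = f(1) g(1) copy_hom[OF X] copy_hom[OF Y] copy_hom[OF Z]
  have "copy Z \<cdot> (g \<cdot> f) = (copy Z \<cdot> g) \<cdot> f"
    by (rule cmp_assoc[symmetric]) (rule homs)+
  also have "\<dots> = ((g \<odot> g) \<cdot> copy Y) \<cdot> f"
    using functional_eq[OF g(1)] g(2) by simp
  also have "\<dots> = (g \<odot> g) \<cdot> (copy Y \<cdot> f)"
    by (rule cmp_assoc) (rule tarr_hom homs)+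
  also have "\<dots> = (g \<odot> g) \<cdot> ((f \<odot> f) \<cdot> copy X)"
    using functional_eq[OF f(1)] f(2) by simp
  also have "\<dots> = ((g \<odot> g) \<cdot> (f \<odot> f)) \<cdot> copy X"
    by (rule cmp_assoc[symmetric]) (rule tarr_hom homs)+
  also have "\<dots> = ((g \<cdot> f) \<odot> (g \<cdot> f)) \<cdot> copy X"
    using tarr_cmp[OF f(1) g(1) f(1) g(1)] by simp
  finally show ?thesis
    using functional_eq[OF cmp_hom[OF f(1) g(1)]] by simp
qed

end


section \<open>Images under a lax gs-monoidal functor\<close>

context lax_gs_monoidal_functor_to_Rel
begin

text \<open>The left unit coherence is an equality with \<open>rel_lunit\<close>, so a point of
  \<open>fobj \<Phi> X\<close> forces \<open>psi0\<close> to have a value.\<close>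

lemma farr_del_total:
  assumes X: "X \<in> obj \<C>" and x: "x \<in> fobj \<Phi> X"
  shows "\<exists>e. (x, e) \<in> farr \<Phi> (del X)"
proof -
  have "(((), x), x) \<in> rel_lunit (fobj \<Phi> X)"
    using x unfolding rel_lunit_def by simp
  then obtain e where "((), e) \<in> psi0 \<Phi>"
    unfolding psi_lunit[OF X, symmetric] rel_tensor_def by blast
  then show ?thesis
    using x unfolding farr_del[OF X] rel_del_def by blast
qed

text \<open>The image of \<open>del (X \<otimes> Y)\<close> is total and factors through the
  projection first. Here \<open>w\<close> may be any point, not only a value of
  \<open>psi\<close>.\<close>

lemma farr_snd_proj_total:
  assumes X: "X \<in> obj \<C>" and Y: "Y \<in> obj \<C>" and w: "w \<in> fobj \<Phi> (X \<otimes> Y)"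
  shows "\<exists>y. (w, y) \<in> farr \<Phi> (snd_proj \<C> X Y)"
  using farr_del_total[OF tobj_obj[OF X Y] w]
  unfolding del_tensor_snd_proj[OF X Y] farr_cmp[OF snd_proj_hom[OF X Y] del_hom[OF Y]]
  by blast

text \<open>Naturality moves the deletion in front of \<open>psi\<close>, where it becomes
  \<open>psi0\<close>, and unit coherence absorbs the rest. Hence \<open>psi\<close> is total on
  pairs and the second component can be read back from its values.\<close>

lemma psi_snd_proj:
  assumes X: "X \<in> obj \<C>" and Y: "Y \<in> obj \<C>"
  shows "psi \<Phi> X Y O farr \<Phi> (snd_proj \<C> X Y) = {((x, y), y) | x y. x \<in> fobj \<Phi> X \<and> y \<in> fobj \<Phi> Y}"
proof -
  have "psi \<Phi> X Y O farr \<Phi> (snd_proj \<C> X Y) = psi \<Phi> X Y O farr \<Phi> (del X \<odot> \<iota> Y) O farr \<Phi> (\<lambda>\<^sub>l Y)"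
    unfolding snd_proj_def
    using farr_cmp[OF tarr_hom[OF del_hom[OF X] idn_hom[OF Y]] lunit_hom[OF Y]] by simp
  also have "\<dots> = (psi \<Phi> X Y O farr \<Phi> (del X \<odot> \<iota> Y)) O farr \<Phi> (\<lambda>\<^sub>l Y)"
    by blast
  also have "\<dots> = (rel_tensor (farr \<Phi> (del X)) (Id_on (fobj \<Phi> Y)) O psi \<Phi> \<I> Y) O farr \<Phi> (\<lambda>\<^sub>l Y)"
    using psi_natural[OF del_hom[OF X] idn_hom[OF Y]] farr_idn[OF Y] by simp
  also have "rel_tensor (farr \<Phi> (del X)) (Id_on (fobj \<Phi> Y))
      = rel_tensor (rel_del (fobj \<Phi> X)) (Id_on (fobj \<Phi> Y))
          O rel_tensor (psi0 \<Phi>) (Id_on (fobj \<Phi> Y))"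
    unfolding farr_del[OF X] rel_tensor_def by blast
  also have "(\<dots> O psi \<Phi> \<I> Y) O farr \<Phi> (\<lambda>\<^sub>l Y)
      = rel_tensor (rel_del (fobj \<Phi> X)) (Id_on (fobj \<Phi> Y)) O rel_lunit (fobj \<Phi> Y)"
    using psi_lunit[OF Y] by (simp add: O_assoc)
  also have "\<dots> = {((x, y), y) | x y. x \<in> fobj \<Phi> X \<and> y \<in> fobj \<Phi> Y}"
    unfolding rel_tensor_def rel_del_def rel_lunit_def by blast
  finally show ?thesis .
qed

lemma farr_braid_total:
  assumes X: "X \<in> obj \<C>" and Y: "Y \<in> obj \<C>" and w: "w \<in> fobj \<Phi> (X \<otimes> Y)"
  shows "\<exists>w'. (w, w') \<in> farr \<Phi> (\<sigma> X Y)"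
proof -
  have "farr \<Phi> (\<sigma> X Y) O farr \<Phi> (\<sigma> Y X) = Id_on (fobj \<Phi> (X \<otimes> Y))"
    using farr_cmp[OF braid_hom[OF X Y] braid_hom[OF Y X]] braid_inverse[OF X Y]
      farr_idn[OF tobj_obj[OF X Y]] by simp
  then show ?thesis using w by blast
qed

text \<open>Some projection \<open>v\<close> of \<open>w\<close> exists by totality, and
  \<open>psi_snd_proj\<close> forces it to equal both \<open>y\<close> and
  \<open>y'\<close>.\<close>

lemma psi_snd_unique:
  assumes X: "X \<in> obj \<C>" and Y: "Y \<in> obj \<C>"
    and w: "((x, y), w) \<in> psi \<Phi> X Y" "((x', y'), w) \<in> psi \<Phi> X Y"
  shows "y = y'"
proof -
  have "w \<in> fobj \<Phi> (X \<otimes> Y)" using psi_rel[OF X Y] w by blast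
  then obtain v where "(w, v) \<in> farr \<Phi> (snd_proj \<C> X Y)"
    using farr_snd_proj_total[OF X Y] by blast
  with w have "((x, y), v) \<in> psi \<Phi> X Y O farr \<Phi> (snd_proj \<C> X Y)"
    "((x', y'), v) \<in> psi \<Phi> X Y O farr \<Phi> (snd_proj \<C> X Y)" by blast+
  then show ?thesis unfolding psi_snd_proj[OF X Y] by blast
qed

text \<open>The braiding swaps the two components and is total, which reduces the claim to the
  second component.\<close>

lemma psi_fst_unique:
  assumes X: "X \<in> obj \<C>" and Y: "Y \<in> obj \<C>"
    and w: "((x, y), w) \<in> psi \<Phi> X Y" "((x', y'), w) \<in> psi \<Phi> X Y"
  shows "x = x'"
proof -
  have "w \<in> fobj \<Phi> (X \<otimes> Y)" using psi_rel[OF X Y] w by blast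
  then obtain w' where "(w, w') \<in> farr \<Phi> (\<sigma> X Y)"
    using farr_braid_total[OF X Y] by blast
  with w have "((x, y), w') \<in> psi \<Phi> X Y O farr \<Phi> (\<sigma> X Y)"
    "((x', y'), w') \<in> psi \<Phi> X Y O farr \<Phi> (\<sigma> X Y)" by blast+
  then have "((y, x), w') \<in> psi \<Phi> Y X" "((y', x'), w') \<in> psi \<Phi> Y X"
    unfolding psi_braid[OF X Y] rel_braid_def by blast+
  then show ?thesis using psi_snd_unique[OF Y X] by blast
qed

text \<open>Two values \<open>x\<close>, \<open>y\<close> at \<open>a\<close> have a common
  \<open>psi\<close>-value \<open>w\<close>. Functionality makes \<open>w\<close> also a
  \<open>psi\<close>-value of some \<open>(z, z)\<close>, and uniqueness of components gives
  \<open>x = z = y\<close>.\<close>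

lemma farr_functional_single_valued:
  assumes f: "f \<in> Hom \<C> X Y" "functional \<C> f" and X: "X \<in> obj \<C>" and Y: "Y \<in> obj \<C>"
  shows "single_valued (farr \<Phi> f)"
proof (rule single_valuedI)
  fix a x y assume ax: "(a, x) \<in> farr \<Phi> f" and ay: "(a, y) \<in> farr \<Phi> f"
  have in_obj: "a \<in> fobj \<Phi> X" "x \<in> fobj \<Phi> Y" "y \<in> fobj \<Phi> Y"
    using farr_rel[OF f(1)] ax ay by blast+
  \<comment> \<open>The projection serves only to show that \<open>psi\<close> has a value at
    \<open>(x, y)\<close>.\<close>
  then have "((x, y), y) \<in> psi \<Phi> Y Y O farr \<Phi> (snd_proj \<C> Y Y)"
    unfolding psi_snd_proj[OF Y Y] by blast
  then obtain w where w: "((x, y), w) \<in> psi \<Phi> Y Y" by blast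
  have "farr \<Phi> ((f \<odot> f) \<cdot> copy X) = (rel_copy (fobj \<Phi> X) O psi \<Phi> X X) O farr \<Phi> (f \<odot> f)"
    using farr_cmp[OF copy_hom[OF X] tarr_hom[OF f(1) f(1)]] farr_copy[OF X] by simp
  also have "\<dots> = rel_copy (fobj \<Phi> X) O rel_tensor (farr \<Phi> f) (farr \<Phi> f) O psi \<Phi> Y Y"
    using psi_natural[OF f(1) f(1)] by (simp add: O_assoc)
  finally have "(a, w) \<in> farr \<Phi> ((f \<odot> f) \<cdot> copy X)"
    using ax ay in_obj w unfolding rel_copy_def rel_tensor_def by blast
  also have "(f \<odot> f) \<cdot> copy X = copy Y \<cdot> f"
    using functional_eq[OF f(1)] f(2) by simp
  also have "farr \<Phi> (copy Y \<cdot> f) = farr \<Phi> f O rel_copy (fobj \<Phi> Y) O psi \<Phi> Y Y"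
    using farr_cmp[OF f(1) copy_hom[OF Y]] farr_copy[OF Y] by simp
  finally obtain z where "((z, z), w) \<in> psi \<Phi> Y Y"
    unfolding rel_copy_def by blast
  then show "x = y"
    using psi_fst_unique[OF Y Y w] psi_snd_unique[OF Y Y w] by blast
qed

end


section \<open>The diagonal argument\<close>

context lax_gs_monoidal_functor_to_Rel
begin

text \<open>The row of \<open>F\<close> named by \<open>q\<close> imitates the diagonal of
  \<open>F\<close> followed by \<open>g\<close>; evaluating that row at its own name
  \<open>q\<close> puts the diagonal on both sides.\<close>

lemma quasi_fixed_point_diagonal:
  assumes A: "A \<in> obj \<C>" and C: "C \<in> obj \<C>" and B: "B \<in> obj \<C>"
    and F: "F \<in> Hom \<C> (C \<otimes> C) B" and g: "g \<in> Hom \<C> B B"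
    and q: "q \<in> Hom \<C> A C" "functional \<C> q"
    and im: "imitates (fobj \<Phi> (A \<otimes> C)) geq (farr \<Phi> (F \<cdot> (q \<odot> \<iota> C)))
      (farr \<Phi> (g \<cdot> F \<cdot> copy C \<cdot> snd_proj \<C> A C))"
  shows "quasi_fixed_point \<C> \<Phi> B geq g (F \<cdot> copy C \<cdot> q)"
proof -
  define k where "k = g \<cdot> F \<cdot> copy C"
  \<comment> \<open>The graph of \<open>q\<close>: the argument is kept beside its value.\<close>
  define h where "h = (\<iota> A \<odot> q) \<cdot> copy A"
  define b where "b = F \<cdot> copy C \<cdot> q"
  note pr = snd_proj_hom[OF A C] and copyC = copy_hom[OF C] and idA = idn_hom[OF A]
    and idC = idn_hom[OF C]
  have Fc: "F \<cdot> copy C \<in> Hom \<C> C B" using cmp_hom[OF copyC F] .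
  have k: "k \<in> Hom \<C> C B" unfolding k_def using cmp_hom[OF Fc g] .
  have h: "h \<in> Hom \<C> A (A \<otimes> C)"
    unfolding h_def by (rule cmp_hom[OF copy_hom[OF A] tarr_hom[OF idA q(1)]])
  have b: "b \<in> Hom \<C> A B" unfolding b_def by (rule cmp_hom[OF cmp_hom[OF q(1) copyC] F])
  have f_eq: "g \<cdot> F \<cdot> copy C \<cdot> snd_proj \<C> A C = k \<cdot> snd_proj \<C> A C"
    unfolding k_def
    using cmp_assoc[OF pr Fc g] cmp_assoc[OF pr copyC F] by simp
  have proj_h: "snd_proj \<C> A C \<cdot> h = q"
  proof -
    have "snd_proj \<C> A C \<cdot> h = (snd_proj \<C> A C \<cdot> (\<iota> A \<odot> q)) \<cdot> copy A"
      unfolding h_def using cmp_assoc[OF copy_hom[OF A] tarr_hom[OF idA q(1)] pr] by simp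
    also have "\<dots> = q \<cdot> snd_proj \<C> A A \<cdot> copy A"
      using snd_proj_natural[OF q(1) A A C] cmp_assoc[OF copy_hom[OF A] snd_proj_hom[OF A A] q(1)]
      by simp
    finally show ?thesis using snd_proj_copy[OF A] cmp_idn_right[OF q(1)] by simp
  qed
  have left: "(F \<cdot> (q \<odot> \<iota> C)) \<cdot> h = b"
  proof -
    have "(F \<cdot> (q \<odot> \<iota> C)) \<cdot> h = F \<cdot> (q \<odot> \<iota> C) \<cdot> h"
      using cmp_assoc[OF h tarr_hom[OF q(1) idC] F] .
    also have "(q \<odot> \<iota> C) \<cdot> h = (q \<odot> q) \<cdot> copy A"
      unfolding h_def
      using cmp_assoc[OF copy_hom[OF A] tarr_hom[OF idA q(1)] tarr_hom[OF q(1) idC]]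
        tarr_split_left[OF q(1) q(1) A C A C] by simp
    \<comment> \<open>Functionality turns two separate uses of \<open>q\<close> into one copied
      value.\<close>
    also have "\<dots> = copy C \<cdot> q" using functional_eq[OF q(1)] q(2) by simp
    finally show ?thesis unfolding b_def .
  qed
  have right: "(k \<cdot> snd_proj \<C> A C) \<cdot> h = g \<cdot> b"
  proof -
    have "(k \<cdot> snd_proj \<C> A C) \<cdot> h = k \<cdot> q"
      using cmp_assoc[OF h pr k] proj_h by simp
    also have "\<dots> = g \<cdot> b"
      unfolding k_def b_def using cmp_assoc[OF q(1) Fc g] cmp_assoc[OF q(1) copyC F] by simp
    finally show ?thesis .
  qed
  \<comment> \<open>Every projection of \<open>w\<close> is a value of \<open>q\<close> at
    \<open>a\<close>. At least one exists by totality and at most one by functionality, so both sets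
    are the same singleton.\<close>
  have const: "farr \<Phi> (snd_proj \<C> A C) `` {w} = farr \<Phi> q `` {a}" if "(a, w) \<in> farr \<Phi> h" for a w
  proof -
    have "w \<in> fobj \<Phi> (A \<otimes> C)" using that farr_rel[OF h] by blast
    then obtain y where "(w, y) \<in> farr \<Phi> (snd_proj \<C> A C)"
      using farr_snd_proj_total[OF A C] by blast
    moreover have "farr \<Phi> q = farr \<Phi> h O farr \<Phi> (snd_proj \<C> A C)"
      using farr_cmp[OF h pr] proj_h by simp
    ultimately show ?thesis
      using that farr_functional_single_valued[OF q A C] unfolding single_valued_def by blast
  qed
  have "imitates (fobj \<Phi> A) geq (farr \<Phi> h O farr \<Phi> (F \<cdot> (q \<odot> \<iota> C)))
      (farr \<Phi> h O farr \<Phi> (k \<cdot> snd_proj \<C> A C))"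
  proof (rule imitates_precomp)
    show "imitates (fobj \<Phi> (A \<otimes> C)) geq (farr \<Phi> (F \<cdot> (q \<odot> \<iota> C))) (farr \<Phi> (k \<cdot> snd_proj \<C> A C))"
      using im unfolding f_eq .
    show "farr \<Phi> h \<subseteq> fobj \<Phi> A \<times> fobj \<Phi> (A \<otimes> C)" using farr_rel[OF h] .
    fix a w w' assume "(a, w) \<in> farr \<Phi> h" "(a, w') \<in> farr \<Phi> h"
      and "farr \<Phi> (k \<cdot> snd_proj \<C> A C) `` {w} \<noteq> {}"
    then show "farr \<Phi> (k \<cdot> snd_proj \<C> A C) `` {w'} \<noteq> {}"
      using const unfolding farr_cmp[OF pr k] relcomp_Image by simp
  qed
  moreover have "farr \<Phi> h O farr \<Phi> (F \<cdot> (q \<odot> \<iota> C)) = farr \<Phi> b"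
    using farr_cmp[OF h cmp_hom[OF tarr_hom[OF q(1) idC] F]] left by simp
  moreover have "farr \<Phi> h O farr \<Phi> (k \<cdot> snd_proj \<C> A C) = farr \<Phi> b O farr \<Phi> g"
    using farr_cmp[OF h cmp_hom[OF pr k]] right farr_cmp[OF b g] by simp
  ultimately have "quasi_fixed_point \<C> \<Phi> B geq g b"
    using b unfolding quasi_fixed_point_def Hom_def by simp
  then show ?thesis unfolding b_def .
qed

end

section \<open>Completeness along a universal simulator, and existence of quasi-fixed points\<close>

context target_context_category_intrinsic
begin

text \<open>If \<open>p\<close> names \<open>f\<close> for \<open>ev\<close>, then
  \<open>r \<cdot> p\<close> names it for \<open>ev \<cdot> s\<close>: universality makes the
  simulated behavior imitate that of \<open>p\<close>, and imitation is transitive.\<close>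

lemma complete_parametrization_universal_simulator:
  assumes A: "A \<in> obj \<C>" and P: "P \<in> obj \<C>"
    and complete: "complete_parametrization \<C> \<Phi> C B geq A T ev"
    and universal: "universal_simulator \<C> \<Phi> T C ev geq P s"
  shows "complete_parametrization \<C> \<Phi> C B geq A P (ev \<cdot> s)"
proof -
  note idC = idn_hom[OF C_obj]
  have s: "s \<in> Hom \<C> (P \<otimes> C) (T \<otimes> C)"
    using universal unfolding universal_simulator_def simulator_def by blast
  obtain r where r: "r \<in> Hom \<C> T P" "functional \<C> r"
    and univ: "ambient_geq \<Phi> geq ev (T \<otimes> C) (s \<cdot> (r \<odot> \<iota> C)) (\<iota> (T \<otimes> C))"
    using universal unfolding universal_simulator_def by blast
  have es: "ev \<cdot> s \<in> Hom \<C> (P \<otimes> C) B" using cmp_hom[OF s ev_hom] .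
  have "\<exists>q \<in> Hom \<C> A P. functional \<C> q \<and>
      imitates (fobj \<Phi> (A \<otimes> C)) geq (farr \<Phi> ((ev \<cdot> s) \<cdot> (q \<odot> \<iota> C))) (farr \<Phi> f)"
    if f: "f \<in> Hom \<C> (A \<otimes> C) B" for f
  proof -
    obtain p where p: "p \<in> Hom \<C> A T" "functional \<C> p"
      and im: "imitates (fobj \<Phi> (A \<otimes> C)) geq (farr \<Phi> (ev \<cdot> (p \<odot> \<iota> C))) (farr \<Phi> f)"
      using complete f unfolding complete_parametrization_def by blast
    have q: "r \<cdot> p \<in> Hom \<C> A P" using cmp_hom[OF p(1) r(1)] .
    note pC = tarr_hom[OF p(1) idC] and rC = tarr_hom[OF r(1) idC]
    note qC = tarr_hom[OF q idC] and srC = cmp_hom[OF rC s]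
    \<comment> \<open>Stability under precomposition is an axiom of the ambient relation, so
      \<open>imitates_precomp\<close> is not the route here.\<close>
    have "ambient_geq \<Phi> geq ev (A \<otimes> C) ((s \<cdot> (r \<odot> \<iota> C)) \<cdot> (p \<odot> \<iota> C)) (\<iota> (T \<otimes> C) \<cdot> (p \<odot> \<iota> C))"
      by (rule ambient_precomp[OF srC idn_hom[OF tobj_obj[OF T_obj C_obj]] pC univ])
    moreover have "(s \<cdot> (r \<odot> \<iota> C)) \<cdot> (p \<odot> \<iota> C) = s \<cdot> ((r \<cdot> p) \<odot> \<iota> C)"
      using cmp_assoc[OF pC rC s] tarr_cmp[OF p(1) r(1) idC idC] cmp_idn_left[OF idC] by simp
    moreover have "\<iota> (T \<otimes> C) \<cdot> (p \<odot> \<iota> C) = p \<odot> \<iota> C"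
      using cmp_idn_left[OF pC] .
    ultimately have "imitates (fobj \<Phi> (A \<otimes> C)) geq
        (farr \<Phi> (ev \<cdot> s \<cdot> ((r \<cdot> p) \<odot> \<iota> C))) (farr \<Phi> (ev \<cdot> (p \<odot> \<iota> C)))"
      unfolding ambient_geq_def
      using farr_cmp[OF cmp_hom[OF qC s] ev_hom] farr_cmp[OF pC ev_hom] by simp
    then have "imitates (fobj \<Phi> (A \<otimes> C)) geq
        (farr \<Phi> (ev \<cdot> s \<cdot> ((r \<cdot> p) \<odot> \<iota> C))) (farr \<Phi> f)"
      using imitates_trans[OF geq_trans farr_rel[OF cmp_hom[OF cmp_hom[OF qC s] ev_hom]]
          farr_rel[OF cmp_hom[OF pC ev_hom]] farr_rel[OF f] _ im] by blast
    then show ?thesis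
      using q functional_cmp[OF p r A T_obj P] cmp_assoc[OF qC s ev_hom] by auto
  qed
  then show ?thesis
    using es unfolding complete_parametrization_def by blast
qed

lemma quasi_fixed_point_exists:
  assumes A: "A \<in> obj \<C>"
    and "complete_parametrization \<C> \<Phi> C B geq A T ev"
    and "universal_simulator \<C> \<Phi> T C ev geq C s"
    and g: "g \<in> Hom \<C> B B"
  shows "\<exists>b. quasi_fixed_point \<C> \<Phi> B geq g b"
proof -
  have complete: "complete_parametrization \<C> \<Phi> C B geq A C (ev \<cdot> s)"
    by (rule complete_parametrization_universal_simulator[OF A C_obj assms(2,3)])
  then have F: "ev \<cdot> s \<in> Hom \<C> (C \<otimes> C) B"
    unfolding complete_parametrization_def by blast
  \<comment> \<open>Programs and contexts share the object \<open>C\<close>, so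
    \<open>copy C\<close> can feed one value into both slots of \<open>ev \<cdot> s\<close>.\<close>
  have "g \<cdot> (ev \<cdot> s) \<cdot> copy C \<cdot> snd_proj \<C> A C \<in> Hom \<C> (A \<otimes> C) B"
    by (rule cmp_hom[OF cmp_hom[OF cmp_hom[OF snd_proj_hom[OF A C_obj] copy_hom[OF C_obj]] F] g])
  then obtain q where "q \<in> Hom \<C> A C" "functional \<C> q"
    and "imitates (fobj \<Phi> (A \<otimes> C)) geq (farr \<Phi> ((ev \<cdot> s) \<cdot> (q \<odot> \<iota> C)))
      (farr \<Phi> (g \<cdot> (ev \<cdot> s) \<cdot> copy C \<cdot> snd_proj \<C> A C))"
    using complete unfolding complete_parametrization_def by blast
  then show ?thesis
    using quasi_fixed_point_diagonal[OF A C_obj B_obj F g] by blast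
qed

end

theorem mainTheorem7:
  fixes \<C> :: "('o, 'm) gs_data"
    and \<Phi> :: "('o, 'm, 'v) rel_functor"
    and T C B A :: 'o
    and ev :: 'm
    and geq :: "'v \<Rightarrow> 'v \<Rightarrow> bool"
  assumes "target_context_category_intrinsic \<C> \<Phi> T C B ev geq"
    and "A \<in> obj \<C>"
    and "complete_parametrization \<C> \<Phi> C B geq A T ev"
    and "\<exists>s. universal_simulator \<C> \<Phi> T C ev geq C s"
  shows "\<forall>g \<in> Hom \<C> B B. \<exists>b. quasi_fixed_point \<C> \<Phi> B geq g b"
  using target_context_category_intrinsic.quasi_fixed_point_exists[OF assms(1-3)] assms(4) by blast

end
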